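(* Let $\alpha\in(0,0.5)$ and $N>1$ be fixed, and let $Q$ be an (anonymous) probability function defining a Markovian policy for the $N$-armed bandit problem. If $Q$ is $\alpha$-exploratory, then the worst-case regret of the policy satisfies $\mathcal R(T)=\Omega(T^{1-\alpha})$ as $T\to\infty$.
   Context: Bandit problem. There are $N$ arms, $[N]=\{1,\dots,N\}$. Each arm $i$ has an i.i.d. reward sequence $\{r_i(t)\}_{t\ge1}$ drawn from a fixed distribution supported on $[0,1]$ with mean $\mu_i$; the collection of reward distributions is the instance $\Theta$. The optimal arm $i^*=\arg\max_i\mu_i$ is assumed unique, and $\mu^*=\max_i\mu_i$. At each time $t=1,2,\dots$ an action $a(t)\in[N]$ is chosen and the reward $r_{a(t)}(t)$ is observed; conditionally on the past and on $a(t)=i$, this reward has arm $i$'s distribution. The regret on instance $\Theta$ is $\mathcal R^\Theta(T)=\mu^*T-\mathbb E\big[\sum_{t=1}^T r_{a(t)}(t)\big]$ and the worst-case regret is $\mathcal R(T)=\sup_\Theta\mathcal R^\Theta(T)$, the supremum being over all $N$-armed instances, separately for each $T$. Markovian policies. Let $k_i(t)=\sum_{\ell=1}^{t-1}\mathbb I\{a(\ell)=i\}$ and $\hat\mu_i(t)=\frac{1}{k_i(t)+1}\sum_{\ell\le t-1:\,a(\ell)=i} r_i(\ell)$. The state at time $t$ is $\mathbf S(t)=(k_1(t),\dots,k_N(t),\hat\mu_1(t),\dots,\hat\mu_N(t))\in\mathcal S=\mathbb Z_+^N\times[0,1]^N$, where $\mathbb Z_+=\{0,1,2,\dots\}$.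 A policy is given by a function $Q=(Q_1,\dots,Q_N)$ from $\mathcal S$ to the probability vectors on $[N]$: given the history up to time $t$, arm $i$ is pulled with probability $Q_i(\mathbf S(t))$. A state is written $(\kappa,u)$, $\kappa\in\mathbb Z_+^N$, $u\in[0,1]^N$. Anonymous (standing assumption on $Q$): for every permutation $\sigma$ of $[N]$, every $i$ and every state, $Q_i(\kappa_{\sigma(1)},\dots,\kappa_{\sigma(N)},u_{\sigma(1)},\dots,u_{\sigma(N)})=Q_{\sigma(i)}(\kappa_1,\dots,\kappa_N,u_1,\dots,u_N)$. $\alpha$-exploratory (for $\alpha\in(0,0.5)$): there exist constants $\varepsilon>0$, $\delta\in(0,1)$ and a sequence $\Delta_1,\Delta_2,\dots$ with $\Delta_T=\Omega(T^{-\alpha})$ such that for all sufficiently large $T$, all $u_1\in[0,1]$ with $u_1\le\Delta_T$, and all $\kappa\in\mathbb Z_+^N$ with $\sum_{i>1}\kappa_i<\delta T$, $$1-Q_1(\kappa_1,\dots,\kappa_N,u_1,0,\dots,0)\ge\varepsilon.$$ Notation: $f(T)=\Omega(g(T))$ means $\liminf_{T\to\infty}f(T)/g(T)>0$. *)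

theory Defs
  imports "HOL-Probability.Probability"
begin

section \<open>Asymptotic lower bounds\<close>

text \<open>The signed notion: unlike \<^const>\<open>bigomega\<close>, which compares norms, it forces
  the left-hand function to be eventually positive when the right-hand one is.\<close>

definition asymp_lower :: "(nat \<Rightarrow> real) \<Rightarrow> (nat \<Rightarrow> real) \<Rightarrow> bool" where
  "asymp_lower f g \<longleftrightarrow> liminf (\<lambda>T. ereal (f T / g T)) > 0"

section \<open>Bandit instances\<close>

abbreviation unit_borel :: "real measure" where
  "unit_borel \<equiv> restrict_space borel {0..1}"

definition arm_mean :: "(nat \<Rightarrow> real measure) \<Rightarrow> nat \<Rightarrow> real" where
  "arm_mean \<Theta> i = (\<integral>x. x \<partial>\<Theta> i)"

definition opt_mean :: "nat \<Rightarrow> (nat \<Rightarrow> real measure) \<Rightarrow> real" where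
  "opt_mean N \<Theta> = Max (arm_mean \<Theta> ` {1..N})"

definition bandit_instances :: "nat \<Rightarrow> (nat \<Rightarrow> real measure) set" where
  "bandit_instances N =
     {\<Theta> \<in> {1..N} \<rightarrow>\<^sub>E space (prob_algebra unit_borel).
        \<exists>!i. i \<in> {1..N} \<and> arm_mean \<Theta> i = opt_mean N \<Theta>}"

section \<open>Histories and states\<close>

text \<open>A trajectory is a sequence of pairs of a pulled arm and a vector of rewards indexed by the
  arms. Trajectories are indexed from 0, so round \<open>t \<ge> 1\<close> is stored at position \<open>t - 1\<close>.\<close>

type_synonym trajectory = "nat \<Rightarrow> nat \<times> (nat \<Rightarrow> real)"
type_synonym state = "(nat \<Rightarrow> nat) \<times> (nat \<Rightarrow> real)"

definition action :: "nat \<Rightarrow> trajectory \<Rightarrow> nat" where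
  "action t \<omega> = fst (\<omega> (t - 1))"

definition reward :: "nat \<Rightarrow> nat \<Rightarrow> trajectory \<Rightarrow> real" where
  "reward i t \<omega> = snd (\<omega> (t - 1)) i"

definition pulls :: "nat \<Rightarrow> nat \<Rightarrow> trajectory \<Rightarrow> nat" where
  "pulls i t \<omega> = (\<Sum>l\<in>{1..<t}. if action l \<omega> = i then 1 else 0)"

definition emp_mean :: "nat \<Rightarrow> nat \<Rightarrow> trajectory \<Rightarrow> real" where
  "emp_mean i t \<omega> =
     1 / (real (pulls i t \<omega>) + 1) * (\<Sum>l | l \<in> {1..<t} \<and> action l \<omega> = i. reward i l \<omega>)"

definition bandit_state :: "nat \<Rightarrow> nat \<Rightarrow> trajectory \<Rightarrow> state" where
  "bandit_state N t \<omega> = (\<lambda>i\<in>{1..N}. pulls i t \<omega>, \<lambda>i\<in>{1..N}. emp_mean i t \<omega>)"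

definition state_space :: "nat \<Rightarrow> state measure" where
  "state_space N =
     PiM {1..N} (\<lambda>_. count_space UNIV) \<Otimes>\<^sub>M PiM {1..N} (\<lambda>_. unit_borel)"

section \<open>Markovian policies\<close>

definition markov_policy :: "nat \<Rightarrow> (state \<Rightarrow> nat \<Rightarrow> real) \<Rightarrow> bool" where
  "markov_policy N Q \<longleftrightarrow>
     (\<forall>s \<in> space (state_space N). (\<forall>i\<in>{1..N}. 0 \<le> Q s i) \<and> (\<Sum>i\<in>{1..N}. Q s i) = 1) \<and>
     (\<forall>i\<in>{1..N}. (\<lambda>s. Q s i) \<in> borel_measurable (state_space N))"

definition anonymous :: "nat \<Rightarrow> (state \<Rightarrow> nat \<Rightarrow> real) \<Rightarrow> bool" where
  "anonymous N Q \<longleftrightarrow>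
     (\<forall>\<sigma> i \<kappa> u. \<sigma> permutes {1..N} \<longrightarrow> i \<in> {1..N} \<longrightarrow> (\<kappa>, u) \<in> space (state_space N) \<longrightarrow>
        Q (\<kappa> \<circ> \<sigma>, u \<circ> \<sigma>) i = Q (\<kappa>, u) (\<sigma> i))"

definition exploratory :: "real \<Rightarrow> nat \<Rightarrow> (state \<Rightarrow> nat \<Rightarrow> real) \<Rightarrow> bool" where
  "exploratory \<alpha> N Q \<longleftrightarrow>
     (\<exists>\<epsilon>>0. \<exists>\<delta>\<in>{0<..<1}. \<exists>\<Delta> :: nat \<Rightarrow> real.
        asymp_lower \<Delta> (\<lambda>T. real T powr (- \<alpha>)) \<and>
        (\<forall>\<^sub>F T in sequentially. \<forall>u\<^sub>1\<in>{0..1}. u\<^sub>1 \<le> \<Delta> T \<longrightarrow>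
           (\<forall>\<kappa> \<in> {1..N} \<rightarrow>\<^sub>E UNIV. real (\<Sum>i\<in>{1<..N}. \<kappa> i) < \<delta> * real T \<longrightarrow>
              1 - Q (\<kappa>, \<lambda>i\<in>{1..N}. if i = 1 then u\<^sub>1 else 0) 1 \<ge> \<epsilon>)))"

section \<open>The law of the process and its regret\<close>

definition round_space :: "nat \<Rightarrow> (nat \<times> (nat \<Rightarrow> real)) measure" where
  "round_space N = count_space {1..N} \<Otimes>\<^sub>M PiM {1..N} (\<lambda>_. unit_borel)"

text \<open>Conditional law of round \<open>n + 1\<close> given rounds \<open>1, \<dots>, n\<close>: the arm is drawn
  according to \<open>Q\<close>, independently of the rewards of that round.\<close>

definition round_kernel ::
  "nat \<Rightarrow> (state \<Rightarrow> nat \<Rightarrow> real) \<Rightarrow> (nat \<Rightarrow> real measure) \<Rightarrow>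
   nat \<Rightarrow> trajectory \<Rightarrow> (nat \<times> (nat \<Rightarrow> real)) measure" where
  "round_kernel N Q \<Theta> n \<omega> =
     point_measure {1..N} (\<lambda>i. ennreal (Q (bandit_state N (Suc n) \<omega>) i)) \<Otimes>\<^sub>M PiM {1..N} \<Theta>"

text \<open>The Ionescu-Tulcea extension of these kernels. The assumptions of that construction are
  discharged in \<open>Ionescu_Tulcea_bandit\<close> below.\<close>

definition bandit_process ::
  "nat \<Rightarrow> (state \<Rightarrow> nat \<Rightarrow> real) \<Rightarrow> (nat \<Rightarrow> real measure) \<Rightarrow> trajectory measure" where
  "bandit_process N Q \<Theta> =
     projective_family.lim UNIV
       (Ionescu_Tulcea.CI (round_kernel N Q \<Theta>) (\<lambda>_. round_space N)) (\<lambda>_. round_space N)"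

definition regret ::
  "nat \<Rightarrow> (state \<Rightarrow> nat \<Rightarrow> real) \<Rightarrow> (nat \<Rightarrow> real measure) \<Rightarrow> nat \<Rightarrow> real" where
  "regret N Q \<Theta> T =
     opt_mean N \<Theta> * real T - (\<integral>\<omega>. (\<Sum>t\<in>{1..T}. reward (action t \<omega>) t \<omega>) \<partial>bandit_process N Q \<Theta>)"

definition worst_case_regret :: "nat \<Rightarrow> (state \<Rightarrow> nat \<Rightarrow> real) \<Rightarrow> nat \<Rightarrow> real" where
  "worst_case_regret N Q T = (SUP \<Theta>\<in>bandit_instances N. regret N Q \<Theta> T)"

lemma measurable_round:
  fixes l n :: nat
  assumes "l \<in> {1..n}"
  shows "(\<lambda>\<omega>. \<omega> (l - 1)) \<in> PiM {0..<n} (\<lambda>_. round_space N) \<rightarrow>\<^sub>M round_space N"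
  using assms by (intro measurable_component_singleton) auto

lemma measurable_action:
  assumes "l \<in> {1..n}"
  shows "action l \<in> PiM {0..<n} (\<lambda>_. round_space N) \<rightarrow>\<^sub>M count_space {1..N}"
  unfolding action_def
  by (rule measurable_compose[OF measurable_round[OF assms]]) (simp add: round_space_def)

lemma measurable_reward:
  assumes "l \<in> {1..n}" "i \<in> {1..N}"
  shows "reward i l \<in> PiM {0..<n} (\<lambda>_. round_space N) \<rightarrow>\<^sub>M unit_borel"
  unfolding reward_def
  by (rule measurable_compose[OF measurable_round[OF assms(1)]])
     (use assms(2) in \<open>auto simp: round_space_def intro!: measurable_compose[OF measurable_snd]\<close>)

lemma pulls_card: "pulls i t \<omega> = card {l \<in> {1..<t}. action l \<omega> = i}"
  unfolding pulls_def by (subst sum.If_cases) (auto intro!: arg_cong[where f=card])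

lemma measurable_bandit_state:
  "bandit_state N (Suc n) \<in> PiM {0..<n} (\<lambda>_. round_space N) \<rightarrow>\<^sub>M state_space N"
proof -
  let ?M = "PiM {0..<n} (\<lambda>_. round_space N)"
  have act: "{\<omega> \<in> space ?M. action l \<omega> = i} \<in> sets ?M" if "l \<in> {1..<Suc n}" for l i
  proof -
    have "action l -` ({i} \<inter> {1..N}) \<inter> space ?M \<in> sets ?M"
      using that by (intro measurable_sets[OF measurable_action]) auto
    also have "action l -` ({i} \<inter> {1..N}) \<inter> space ?M = {\<omega> \<in> space ?M. action l \<omega> = i}"
      using measurable_space[OF measurable_action, of l n _ N] that by auto
    finally show ?thesis .
  qed
  have pulls: "pulls i (Suc n) \<in> ?M \<rightarrow>\<^sub>M count_space UNIV" for i
    unfolding pulls_def using act by measurable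
  have rew: "reward i l \<in> borel_measurable ?M" if "l \<in> {1..<Suc n}" "i \<in> {1..N}" for l i
    using measurable_reward[of l n i N] that by (auto simp: measurable_restrict_space2_iff)
  have emp: "emp_mean i (Suc n) \<in> ?M \<rightarrow>\<^sub>M unit_borel" if i: "i \<in> {1..N}" for i
  proof (rule measurable_restrict_space2)
    have eq: "emp_mean i (Suc n) = (\<lambda>\<omega>. 1 / (real (pulls i (Suc n) \<omega>) + 1) *
        (\<Sum>l\<in>{1..<Suc n}. if action l \<omega> = i then reward i l \<omega> else 0))"
      unfolding emp_mean_def by (intro ext arg_cong2[where f="(*)"] refl) (subst sum.inter_filter[symmetric], auto)
    have "(\<lambda>\<omega>. real (pulls i (Suc n) \<omega>)) \<in> borel_measurable ?M"
      using pulls by measurable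
    then show "emp_mean i (Suc n) \<in> borel_measurable ?M"
      unfolding eq
      by (intro borel_measurable_times borel_measurable_divide borel_measurable_add borel_measurable_sum
            measurable_If rew act) (use i in auto)
    show "emp_mean i (Suc n) \<in> space ?M \<rightarrow> {0..1}"
    proof
      fix \<omega> assume \<omega>: "\<omega> \<in> space ?M"
      have r: "0 \<le> reward i l \<omega> \<and> reward i l \<omega> \<le> 1" if "l \<in> {1..<Suc n}" for l
        using measurable_space[OF measurable_reward \<omega>, of l i] that i by auto
      have "(\<Sum>l | l \<in> {1..<Suc n} \<and> action l \<omega> = i. reward i l \<omega>)
          \<le> (\<Sum>l | l \<in> {1..<Suc n} \<and> action l \<omega> = i. 1)"
        by (intro sum_mono) (use r in auto)
      also have "\<dots> = real (pulls i (Suc n) \<omega>)"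
        by (simp add: pulls_card)
      finally have "(\<Sum>l | l \<in> {1..<Suc n} \<and> action l \<omega> = i. reward i l \<omega>) \<le> real (pulls i (Suc n) \<omega>) + 1"
        by simp
      moreover have "0 \<le> (\<Sum>l | l \<in> {1..<Suc n} \<and> action l \<omega> = i. reward i l \<omega>)"
        by (intro sum_nonneg) (use r in auto)
      ultimately show "emp_mean i (Suc n) \<omega> \<in> {0..1}"
        unfolding emp_mean_def by (auto simp: divide_simps)
    qed
  qed
  show ?thesis
    unfolding bandit_state_def state_space_def
    by (intro measurable_Pair measurable_restrict pulls emp)
qed

lemma measurable_arm_law:
  assumes "markov_policy N Q"
  shows "(\<lambda>s. point_measure {1..N} (\<lambda>i. ennreal (Q s i)))
           \<in> state_space N \<rightarrow>\<^sub>M prob_algebra (count_space {1..N})"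
proof (intro measurable_prob_algebraI measurable_subprob_algebra prob_space_imp_subprob_space)
  fix s assume s: "s \<in> space (state_space N)"
  have "(\<Sum>i\<in>{1..N}. ennreal (Q s i)) = ennreal (\<Sum>i\<in>{1..N}. Q s i)"
    using assms s by (intro sum_ennreal) (auto simp: markov_policy_def)
  also have "\<dots> = 1"
    using assms s by (simp add: markov_policy_def)
  finally show "prob_space (point_measure {1..N} (\<lambda>i. ennreal (Q s i)))"
    by (intro prob_space_point_measure) auto
  then show "prob_space (point_measure {1..N} (\<lambda>i. ennreal (Q s i)))" .
next
  fix A assume A: "A \<in> sets (count_space {1..N})"
  then have "(\<lambda>s. emeasure (point_measure {1..N} (\<lambda>i. ennreal (Q s i))) A) = (\<lambda>s. \<Sum>i\<in>A. ennreal (Q s i))"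
    by (intro ext emeasure_point_measure_finite) auto
  moreover have "\<dots> \<in> borel_measurable (state_space N)"
    using assms A by (intro borel_measurable_sum measurable_compose[OF _ measurable_ennreal]) (auto simp: markov_policy_def)
  ultimately show "(\<lambda>s. emeasure (point_measure {1..N} (\<lambda>i. ennreal (Q s i))) A) \<in> borel_measurable (state_space N)"
    by simp
qed (simp add: sets_point_measure)

lemma PiM_rewards_prob:
  assumes "\<Theta> \<in> {1..N} \<rightarrow>\<^sub>E space (prob_algebra unit_borel)"
  shows "PiM {1..N} \<Theta> \<in> space (prob_algebra (PiM {1..N} (\<lambda>_. unit_borel)))"
proof -
  have "prob_space (PiM {1..N} \<Theta>)"
    using assms by (intro prob_space_PiM) (auto simp: space_prob_algebra)
  moreover have "sets (PiM {1..N} \<Theta>) = sets (PiM {1..N} (\<lambda>_. unit_borel))"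
    using assms by (intro sets_PiM_cong) (auto simp: space_prob_algebra)
  ultimately show ?thesis by (simp add: space_prob_algebra)
qed

lemma Ionescu_Tulcea_bandit:
  assumes "markov_policy N Q" "\<Theta> \<in> bandit_instances N"
  shows "Ionescu_Tulcea (round_kernel N Q \<Theta>) (\<lambda>_. round_space N)"
proof -
  have *: "round_kernel N Q \<Theta> n \<in> PiM {0..<n} (\<lambda>_. round_space N) \<rightarrow>\<^sub>M prob_algebra (round_space N)" for n
    unfolding round_kernel_def round_space_def
    by (intro measurable_pair_prob measurable_const PiM_rewards_prob
          measurable_compose[OF measurable_bandit_state[unfolded round_space_def] measurable_arm_law])
       (use assms in \<open>auto simp: bandit_instances_def\<close>)
  show ?thesis
    using measurable_space[OF *]
    by (intro Ionescu_Tulcea.intro measurable_prob_algebraD[OF *]) (auto simp: space_prob_algebra)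
qed

lemma prob_space_bandit_process:
  assumes "markov_policy N Q" "\<Theta> \<in> bandit_instances N"
  shows "prob_space (bandit_process N Q \<Theta>)"
proof -
  interpret IT: Ionescu_Tulcea "round_kernel N Q \<Theta>" "\<lambda>_. round_space N"
    using assms by (rule Ionescu_Tulcea_bandit)
  have "(\<lambda>x. restrict x {}) \<in> IT.PF.lim \<rightarrow>\<^sub>M PiM {} (\<lambda>_. round_space N)"
    by (simp add: measurable_cong_sets[OF IT.PF.sets_lim refl] measurable_restrict_subset)
  moreover have "prob_space (distr IT.PF.lim (PiM {} (\<lambda>_. round_space N)) (\<lambda>x. restrict x {}))"
    by (simp add: IT.distr_lim IT.PF.prob_space_P)
  ultimately show ?thesis
    unfolding bandit_process_def by (rule prob_space_distrD)
qed

end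

theory Submission
  imports Defs
begin

text \<open>
  Take the instance in which arm \<open>1\<close> always pays \<open>c\<close>, a constant multiple of \<open>T powr (- \<alpha>)\<close> with
  \<open>c \<le> \<Delta> T\<close>, and every other arm always pays \<open>0\<close>. The empirical mean of arm \<open>1\<close> never exceeds
  \<open>c\<close> and the others vanish, so the policy leaves arm \<open>1\<close> with conditional probability at least
  \<open>\<epsilon>\<close> as long as the number of pulls of other arms is below \<open>\<delta> T\<close>. If \<open>K\<close> is the number of such
  pulls in all \<open>T\<close> rounds, each round is one of them with probability at least
  \<open>\<epsilon> (1 - E[K] / (\<delta> T))\<close>. Summing over the rounds gives \<open>E[K] \<ge> \<epsilon> \<delta> T / (\<epsilon> + \<delta>)\<close>, and each such pull
  costs \<open>c\<close>.
\<close>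

section \<open>One step of the Ionescu-Tulcea extension\<close>

context Ionescu_Tulcea
begin

text \<open>\<open>CI J\<close> runs the kernels up to the bound \<open>up_to J\<close> and then
  projects onto \<open>J\<close>. On an initial segment this bound is \<open>n\<close> and the
  projection keeps every coordinate, so the marginals used below are plain compositions of
  kernels.\<close>

lemma CI_initial: "CI {0..<n} = C 0 n (\<lambda>_. undefined)"
proof -
  have "up_to {0..<n} = n"
    using up_to[of "{0..<n}"] by (intro antisym) (auto simp: up_to_iff_Ico)
  then show ?thesis
    unfolding CI_def using distr_C[of n n "\<lambda>_. undefined" 0] by simp
qed

lemma measurable_lim_restrict:
  "(\<lambda>\<omega>. restrict \<omega> J) \<in> PF.lim \<rightarrow>\<^sub>M PiM J M"
  by (simp add: measurable_cong_sets[OF PF.sets_lim refl] measurable_restrict_subset)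

text \<open>The event looks only at the first \<open>Suc n\<close> coordinates, whose law is that of
  the first \<open>n\<close> followed by one kernel step. The past is integrated over the limit
  measure itself, so that all rounds can later be compared on one probability space.\<close>

lemma emeasure_lim_component:
  assumes A[measurable]: "A \<in> sets (M n)"
  shows "emeasure PF.lim ((\<lambda>\<omega>. \<omega> n) -` A \<inter> space PF.lim)
       = (\<integral>\<^sup>+\<omega>. emeasure (P n (restrict \<omega> {0..<n})) A \<partial>PF.lim)"
proof -
  let ?B = "(\<lambda>\<omega>. \<omega> n) -` A \<inter> space (PiM {0..<Suc n} M)"
  have B[measurable]: "?B \<in> sets (PiM {0..<Suc n} M)"
    by (rule measurable_sets[OF _ A]) (simp add: measurable_component_singleton)
  have "(\<lambda>\<omega>. \<omega> n) -` A \<inter> space PF.lim = (\<lambda>\<omega>. restrict \<omega> {0..<Suc n}) -` ?B \<inter> space PF.lim"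
    by (auto simp: space_PiM PiE_iff)
  then have "emeasure PF.lim ((\<lambda>\<omega>. \<omega> n) -` A \<inter> space PF.lim)
      = emeasure (distr PF.lim (PiM {0..<Suc n} M) (\<lambda>\<omega>. restrict \<omega> {0..<Suc n})) ?B"
    by (simp only: emeasure_distr[OF measurable_lim_restrict B])
  also have "\<dots> = emeasure (C 0 (Suc n) (\<lambda>_. undefined)) ?B"
    by (simp only: distr_lim finite_atLeastLessThan CI_initial)
  \<comment> \<open>\<open>C 0 (Suc n)\<close> is \<open>C 0 n\<close> bound to \<open>eP n\<close>,
    which appends a sample of \<open>P n\<close> at position \<open>n\<close>.\<close>
  also have "\<dots> = (\<integral>\<^sup>+\<omega>. emeasure (eP n \<omega>) ?B \<partial>C 0 n (\<lambda>_. undefined))"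
    using measurable_eP[of n]
    by (simp del: space_PiM) (subst emeasure_bind[where N="PiM {0..<Suc n} M"],
        auto simp: space_C measurable_cong_sets[OF sets_C refl])
  also have "\<dots> = (\<integral>\<^sup>+\<omega>. emeasure (P n \<omega>) A \<partial>C 0 n (\<lambda>_. undefined))"
  proof (intro nn_integral_cong)
    fix \<omega> assume "\<omega> \<in> space (C 0 n (\<lambda>_. undefined))"
    then have \<omega>: "\<omega> \<in> space (PiM {0..<n} M)"
      by (simp add: space_C)
    \<comment> \<open>Only the appended coordinate is tested, so the past drops out of the
      preimage.\<close>
    have "fun_upd \<omega> n -` ?B \<inter> space (M n) = A"
      using \<omega> sets.sets_into_space[OF A]
      by (auto simp: space_PiM PiE_iff extensional_def)
    then show "emeasure (eP n \<omega>) ?B = emeasure (P n \<omega>) A"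
      by (simp add: emeasure_eP[OF \<omega> B])
  qed
  also have "\<dots> = (\<integral>\<^sup>+\<omega>. emeasure (P n \<omega>) A \<partial>distr PF.lim (PiM {0..<n} M) (\<lambda>\<omega>. restrict \<omega> {0..<n}))"
    by (simp only: distr_lim finite_atLeastLessThan CI_initial)
  also have "\<dots> = (\<integral>\<^sup>+\<omega>. emeasure (P n (restrict \<omega> {0..<n})) A \<partial>PF.lim)"
    by (rule nn_integral_distr[OF measurable_lim_restrict]) measurable
  finally show ?thesis .
qed

end

section \<open>Rounds of the bandit process\<close>

lemma space_bandit_process:
  assumes "markov_policy N Q" "\<Theta> \<in> bandit_instances N"
  shows "space (bandit_process N Q \<Theta>) = space (PiM UNIV (\<lambda>_. round_space N))"
proof -
  interpret IT: Ionescu_Tulcea "round_kernel N Q \<Theta>" "\<lambda>_. round_space N"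
    using assms by (rule Ionescu_Tulcea_bandit)
  show ?thesis by (simp add: bandit_process_def)
qed

lemma action_in_arms:
  assumes "\<omega> \<in> space (PiM UNIV (\<lambda>_. round_space N))"
  shows "action t \<omega> \<in> {1..N}"
  using assms by (force simp: space_PiM round_space_def space_pair_measure action_def PiE_iff mem_Times_iff)

lemma reward_in_unit:
  assumes "\<omega> \<in> space (PiM UNIV (\<lambda>_. round_space N))" "i \<in> {1..N}"
  shows "reward i t \<omega> \<in> {0..1}"
proof -
  have "\<omega> (t - 1) \<in> space (round_space N)"
    using assms(1) by (auto simp: space_PiM)
  then have "snd (\<omega> (t - 1)) \<in> {1..N} \<rightarrow>\<^sub>E {0..1}"
    by (auto simp: round_space_def space_pair_measure space_PiM)
  then show ?thesis
    using assms(2) unfolding reward_def by blast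
qed

text \<open>The state before round \<open>Suc n\<close> depends on rounds 1 to \<open>n\<close>
  only, stored at positions 0 to \<open>n - 1\<close>. Hence a kernel fed with the truncated past
  agrees with the one fed with the whole trajectory.\<close>

lemma bandit_state_restrict:
  "bandit_state N (Suc n) (restrict \<omega> {0..<n}) = bandit_state N (Suc n) \<omega>"
proof -
  have eq: "action l (restrict \<omega> {0..<n}) = action l \<omega>" "reward i l (restrict \<omega> {0..<n}) = reward i l \<omega>"
    if "l \<in> {1..<Suc n}" for l i
    using that by (auto simp: action_def reward_def)
  have "pulls i (Suc n) (restrict \<omega> {0..<n}) = pulls i (Suc n) \<omega>" for i
    unfolding pulls_def by (intro sum.cong refl) (simp add: eq del: restrict_apply)
  moreover have "(\<Sum>l | l \<in> {1..<Suc n} \<and> action l (restrict \<omega> {0..<n}) = i. reward i l (restrict \<omega> {0..<n}))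
      = (\<Sum>l | l \<in> {1..<Suc n} \<and> action l \<omega> = i. reward i l \<omega>)" for i
    by (intro sum.cong) (auto simp: eq simp del: restrict_apply)
  ultimately show ?thesis
    by (simp add: bandit_state_def emp_mean_def)
qed

lemma emeasure_bandit_round:
  assumes "markov_policy N Q" "\<Theta> \<in> bandit_instances N" "A \<in> sets (round_space N)"
  shows "emeasure (bandit_process N Q \<Theta>) ((\<lambda>\<omega>. \<omega> n) -` A \<inter> space (bandit_process N Q \<Theta>))
       = (\<integral>\<^sup>+\<omega>. emeasure (round_kernel N Q \<Theta> n \<omega>) A \<partial>bandit_process N Q \<Theta>)"
proof -
  interpret IT: Ionescu_Tulcea "round_kernel N Q \<Theta>" "\<lambda>_. round_space N"
    using assms(1,2) by (rule Ionescu_Tulcea_bandit)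
  show ?thesis
    using IT.emeasure_lim_component[OF assms(3), of n]
    unfolding bandit_process_def by (simp add: round_kernel_def bandit_state_restrict)
qed

lemma measurable_bandit_process_component:
  assumes "markov_policy N Q" "\<Theta> \<in> bandit_instances N"
  shows "(\<lambda>\<omega>. \<omega> n) \<in> bandit_process N Q \<Theta> \<rightarrow>\<^sub>M round_space N"
proof -
  interpret IT: Ionescu_Tulcea "round_kernel N Q \<Theta>" "\<lambda>_. round_space N"
    using assms by (rule Ionescu_Tulcea_bandit)
  show ?thesis
    unfolding bandit_process_def
    by (simp add: measurable_cong_sets[OF IT.PF.sets_lim refl])
qed

lemma measurable_bandit_process_state:
  assumes "markov_policy N Q" "\<Theta> \<in> bandit_instances N"
  shows "bandit_state N (Suc n) \<in> bandit_process N Q \<Theta> \<rightarrow>\<^sub>M state_space N"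
proof -
  interpret IT: Ionescu_Tulcea "round_kernel N Q \<Theta>" "\<lambda>_. round_space N"
    using assms by (rule Ionescu_Tulcea_bandit)
  show ?thesis
    using measurable_compose[OF IT.measurable_lim_restrict measurable_bandit_state[of N n]]
    unfolding bandit_process_def by (simp add: bandit_state_restrict)
qed

section \<open>Law of the arm and of the rewards in a single round\<close>

lemma prob_space_rewards:
  assumes "\<Theta> \<in> bandit_instances N"
  shows "prob_space (PiM {1..N} \<Theta>)"
  using PiM_rewards_prob[of \<Theta> N] assms by (auto simp: bandit_instances_def space_prob_algebra)

lemma sets_rewards:
  assumes "\<Theta> \<in> bandit_instances N"
  shows "sets (PiM {1..N} \<Theta>) = sets (PiM {1..N} (\<lambda>_. unit_borel))"
  using PiM_rewards_prob[of \<Theta> N] assms by (auto simp: bandit_instances_def space_prob_algebra)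

lemma sum_policy:
  assumes "markov_policy N Q" "s \<in> space (state_space N)" "I \<subseteq> {1..N}"
  shows "(\<Sum>i\<in>I. Q s i) + (\<Sum>i\<in>{1..N} - I. Q s i) = 1"
  using sum.subset_diff[OF assms(3), of "Q s"] assms(1,2) by (simp add: markov_policy_def)

lemma policy_le_1:
  assumes "markov_policy N Q" "s \<in> space (state_space N)" "i \<in> {1..N}"
  shows "Q s i \<le> 1"
proof -
  have "(\<Sum>j\<in>{1..N} - {i}. Q s j) \<ge> 0"
    using assms by (intro sum_nonneg) (auto simp: markov_policy_def)
  with sum_policy[OF assms(1,2), of "{i}"] assms(3) show ?thesis by simp
qed

text \<open>Given the past, the arm and the reward vector of a round are independent, so rectangles
  factorise. Membership of the state in \<open>state_space N\<close> makes the policy weights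
  nonnegative, which lets \<open>ennreal\<close> commute with their sum.\<close>

lemma emeasure_round_kernel_Times:
  assumes "markov_policy N Q" "\<Theta> \<in> bandit_instances N" "I \<subseteq> {1..N}"
    and "B \<in> sets (PiM {1..N} (\<lambda>_. unit_borel))"
    and "bandit_state N (Suc n) \<omega> \<in> space (state_space N)"
  shows "emeasure (round_kernel N Q \<Theta> n \<omega>) (I \<times> B)
       = ennreal (\<Sum>i\<in>I. Q (bandit_state N (Suc n) \<omega>) i) * emeasure (PiM {1..N} \<Theta>) B"
proof -
  interpret R: prob_space "PiM {1..N} \<Theta>"
    by (rule prob_space_rewards[OF assms(2)])
  have "emeasure (point_measure {1..N} (\<lambda>i. ennreal (Q (bandit_state N (Suc n) \<omega>) i))) I
      = (\<Sum>i\<in>I. ennreal (Q (bandit_state N (Suc n) \<omega>) i))"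
    using assms(3) by (intro emeasure_point_measure_finite) auto
  also have "\<dots> = ennreal (\<Sum>i\<in>I. Q (bandit_state N (Suc n) \<omega>) i)"
    using assms by (intro sum_ennreal) (auto simp: markov_policy_def)
  finally show ?thesis
    unfolding round_kernel_def using assms
    by (subst R.emeasure_pair_measure_Times) (auto simp: sets_point_measure sets_rewards simp del: One_nat_def)
qed

text \<open>Averages the conditional probability of a pull in \<open>I\<close> over the past. This
  is how bounds on the policy become bounds on expected numbers of pulls.\<close>

lemma prob_action_in:
  assumes mp: "markov_policy N Q" and inst: "\<Theta> \<in> bandit_instances N" and I: "I \<subseteq> {1..N}"
  shows "measure (bandit_process N Q \<Theta>) {\<omega> \<in> space (bandit_process N Q \<Theta>). action (Suc n) \<omega> \<in> I}
       = (\<integral>\<omega>. (\<Sum>i\<in>I. Q (bandit_state N (Suc n) \<omega>) i) \<partial>bandit_process N Q \<Theta>)"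
proof -
  let ?M = "bandit_process N Q \<Theta>"
  let ?q = "\<lambda>\<omega>. \<Sum>i\<in>I. Q (bandit_state N (Suc n) \<omega>) i"
  let ?B = "space (PiM {1..N} (\<lambda>_. unit_borel))"
  note st = measurable_bandit_process_state[OF mp inst, of n]
  have B: "?B = space (PiM {1..N} \<Theta>)"
    using sets_eq_imp_space_eq[OF sets_rewards[OF inst]] by simp
  have q0: "0 \<le> ?q \<omega>" if "\<omega> \<in> space ?M" for \<omega>
    using measurable_space[OF st that] mp I by (intro sum_nonneg) (auto simp: markov_policy_def)
  have qm: "?q \<in> borel_measurable ?M"
    using I mp by (intro borel_measurable_sum measurable_compose[OF st]) (auto simp: markov_policy_def)
  \<comment> \<open>Round \<open>Suc n\<close> sits at position \<open>n\<close>; taking the whole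
    reward space as second side leaves the rewards free.\<close>
  have "{\<omega> \<in> space ?M. action (Suc n) \<omega> \<in> I} = (\<lambda>\<omega>. \<omega> n) -` (I \<times> ?B) \<inter> space ?M"
    using measurable_space[OF measurable_bandit_process_component[OF mp inst, of n]]
    by (auto simp: action_def round_space_def space_pair_measure mem_Times_iff)
  then have "emeasure ?M {\<omega> \<in> space ?M. action (Suc n) \<omega> \<in> I}
      = (\<integral>\<^sup>+\<omega>. emeasure (round_kernel N Q \<Theta> n \<omega>) (I \<times> ?B) \<partial>?M)"
    using I by (simp only:) (intro emeasure_bandit_round[OF mp inst], auto simp: round_space_def)
  also have "\<dots> = (\<integral>\<^sup>+\<omega>. ennreal (?q \<omega>) \<partial>?M)"
    using prob_space.emeasure_space_1[OF prob_space_rewards[OF inst], folded B]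
    by (intro nn_integral_cong, subst emeasure_round_kernel_Times[OF mp inst I])
       (auto simp: B[symmetric] measurable_space[OF st] simp del: One_nat_def)
  finally show ?thesis
    unfolding measure_def
    by (subst integral_eq_nn_integral[OF qm]) (auto intro!: AE_I2 q0)
qed

text \<open>The kernel draws a reward for every arm in every round, whichever arm is pulled, so each
  reward of arm \<open>i\<close> has law \<open>\<Theta> i\<close> independently of the policy. The
  null-set form is what point masses call for.\<close>

lemma AE_bandit_rewards:
  assumes mp: "markov_policy N Q" and inst: "\<Theta> \<in> bandit_instances N"
    and i: "i \<in> {1..N}" and A: "A \<in> sets unit_borel" and null: "emeasure (\<Theta> i) A = 0"
  shows "AE \<omega> in bandit_process N Q \<Theta>. reward i (Suc n) \<omega> \<notin> A"
proof -
  let ?M = "bandit_process N Q \<Theta>"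
  let ?B = "(\<lambda>x. x i) -` A \<inter> space (PiM {1..N} (\<lambda>_. unit_borel))"
  note st = measurable_bandit_process_state[OF mp inst, of n]
  have th: "prob_space (\<Theta> j)" "sets (\<Theta> j) = sets unit_borel" if "j \<in> {1..N}" for j
    using inst that by (auto simp: bandit_instances_def space_prob_algebra PiE_iff)
  have B: "?B \<in> sets (PiM {1..N} (\<lambda>_. unit_borel))"
    using i A by (intro measurable_sets[OF measurable_component_singleton]) auto
  have "emeasure (PiM {1..N} \<Theta>) ?B
      = emeasure (distr (PiM {1..N} \<Theta>) (\<Theta> i) (\<lambda>x. x i)) A"
    using i A th sets_eq_imp_space_eq[OF sets_rewards[OF inst]]
    by (subst emeasure_distr) auto
  also have "\<dots> = 0"
    using i th null by (subst distr_PiM_component) auto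
  finally have B0: "emeasure (PiM {1..N} \<Theta>) ?B = 0" .
  have AB: "{1..N} \<times> ?B \<in> sets (round_space N)"
    unfolding round_space_def using B by auto
  have "{\<omega> \<in> space ?M. reward i (Suc n) \<omega> \<in> A} = (\<lambda>\<omega>. \<omega> n) -` ({1..N} \<times> ?B) \<inter> space ?M"
    using measurable_space[OF measurable_bandit_process_component[OF mp inst, of n]]
    by (auto simp: reward_def round_space_def space_pair_measure mem_Times_iff)
  then have eq: "emeasure ?M {\<omega> \<in> space ?M. reward i (Suc n) \<omega> \<in> A}
      = (\<integral>\<^sup>+\<omega>. emeasure (round_kernel N Q \<Theta> n \<omega>) ({1..N} \<times> ?B) \<partial>?M)"
    by (simp only: emeasure_bandit_round[OF mp inst AB])
  also have "\<dots> = (\<integral>\<^sup>+\<omega>. 0 \<partial>?M)"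
    by (intro nn_integral_cong, subst emeasure_round_kernel_Times[OF mp inst _ B])
       (auto simp: B0 measurable_space[OF st] simp del: One_nat_def)
  finally have "emeasure ?M {\<omega> \<in> space ?M. reward i (Suc n) \<omega> \<in> A} = 0" by simp
  moreover have "{\<omega> \<in> space ?M. reward i (Suc n) \<omega> \<in> A} \<in> sets ?M"
    using measurable_sets[OF measurable_bandit_process_component[OF mp inst, of n] AB]
      \<open>_ = (\<lambda>\<omega>. \<omega> n) -` ({1..N} \<times> ?B) \<inter> space ?M\<close> by simp
  ultimately show ?thesis
    by (intro AE_I[where N="{\<omega> \<in> space ?M. reward i (Suc n) \<omega> \<in> A}"]) auto
qed

section \<open>Upper bound on the regret\<close>

lemma opt_mean_le_1:
  assumes "\<Theta> \<in> bandit_instances N" "N > 0"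
  shows "opt_mean N \<Theta> \<le> 1"
proof -
  have "arm_mean \<Theta> i \<le> 1" if i: "i \<in> {1..N}" for i
  proof -
    have th: "prob_space (\<Theta> i)" "sets (\<Theta> i) = sets unit_borel"
      using assms(1) i by (auto simp: bandit_instances_def space_prob_algebra PiE_iff)
    interpret prob_space "\<Theta> i" by fact
    have sp: "space (\<Theta> i) = {0..1}"
      using sets_eq_imp_space_eq[OF th(2)] by simp
    have "(\<lambda>x. x) \<in> borel_measurable (\<Theta> i)"
      by (simp add: measurable_cong_sets[OF th(2) refl] measurable_restrict_space1)
    then have "integrable (\<Theta> i) (\<lambda>x. x)"
      by (intro integrable_const_bound[of _ 1] AE_I2) (auto simp: sp)
    then show ?thesis
      unfolding arm_mean_def by (intro integral_le_const AE_I2) (auto simp: sp)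
  qed
  then show ?thesis
    unfolding opt_mean_def using assms(2) by (subst Max_le_iff) auto
qed

text \<open>Rewards are nonnegative and the optimal mean is at most 1. The bound is uniform in
  \<open>\<Theta>\<close>, so the set under the real-valued \<open>SUP\<close> in
  \<open>worst_case_regret\<close> is bounded above and the \<open>SUP\<close> dominates each of its
  members.\<close>

lemma regret_le:
  assumes mp: "markov_policy N Q" and inst: "\<Theta> \<in> bandit_instances N" and N: "N > 0"
  shows "regret N Q \<Theta> T \<le> real T"
proof -
  have "0 \<le> reward (action t \<omega>) t \<omega>" if "\<omega> \<in> space (bandit_process N Q \<Theta>)" for t \<omega>
    using reward_in_unit[OF _ action_in_arms] that
    by (simp add: space_bandit_process[OF mp inst])
  \<comment> \<open>No integrability is checked here: a non-integrable function would have the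
    default integral 0.\<close>
  then have "0 \<le> (\<integral>\<omega>. (\<Sum>t\<in>{1..T}. reward (action t \<omega>) t \<omega>) \<partial>bandit_process N Q \<Theta>)"
    by (intro integral_nonneg_AE AE_I2 sum_nonneg)
  moreover have "opt_mean N \<Theta> * real T \<le> 1 * real T"
    using opt_mean_le_1[OF inst N] by (intro mult_right_mono) auto
  ultimately show ?thesis
    unfolding regret_def by simp
qed

lemma regret_le_worst_case:
  assumes mp: "markov_policy N Q" and inst: "\<Theta> \<in> bandit_instances N" and N: "N > 0"
  shows "regret N Q \<Theta> T \<le> worst_case_regret N Q T"
  unfolding worst_case_regret_def
  by (intro cSUP_upper inst bdd_aboveI2[where M="real T"] regret_le mp N)

section \<open>The instance with a single profitable arm\<close>

text \<open>Point masses keep the empirical means of all arms but the first at 0, which are the only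
  states that \<open>exploratory\<close> speaks about.\<close>

definition single_arm_instance :: "nat \<Rightarrow> real \<Rightarrow> nat \<Rightarrow> real measure" where
  "single_arm_instance N c = (\<lambda>i\<in>{1..N}. return unit_borel (if i = 1 then c else 0))"

lemma arm_mean_single_arm:
  assumes "i \<in> {1..N}" "0 \<le> c" "c \<le> 1"
  shows "arm_mean (single_arm_instance N c) i = (if i = 1 then c else 0)"
  using assms unfolding arm_mean_def single_arm_instance_def
  by (simp add: integral_return measurable_restrict_space1)

lemma opt_mean_single_arm:
  assumes "N > 0" "0 \<le> c" "c \<le> 1"
  shows "opt_mean N (single_arm_instance N c) = c"
  unfolding opt_mean_def using assms
  by (intro Max_eqI) (auto simp: arm_mean_single_arm intro!: image_eqI[of _ _ 1])

text \<open>Strict positivity of \<open>c\<close> separates arm 1 from the others, whose means are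
  0, and so makes the best arm unique.\<close>

lemma single_arm_instance_in:
  assumes "N > 0" "0 < c" "c \<le> 1"
  shows "single_arm_instance N c \<in> bandit_instances N"
proof -
  have "single_arm_instance N c \<in> {1..N} \<rightarrow>\<^sub>E space (prob_algebra unit_borel)"
    using assms by (auto simp: single_arm_instance_def space_prob_algebra intro!: prob_space_return)
  moreover have "\<exists>!i. i \<in> {1..N} \<and> arm_mean (single_arm_instance N c) i = opt_mean N (single_arm_instance N c)"
    using assms by (intro ex1I[of _ 1]) (auto simp: opt_mean_single_arm arm_mean_single_arm split: if_splits)
  ultimately show ?thesis
    by (simp add: bandit_instances_def)
qed

lemma AE_single_arm_rewards:
  assumes mp: "markov_policy N Q" and N: "N > 0" and c: "0 < c" "c \<le> 1"
  shows "AE \<omega> in bandit_process N Q (single_arm_instance N c).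
           \<forall>t\<ge>1. \<forall>i\<in>{1..N}. reward i t \<omega> = (if i = 1 then c else 0)"
proof -
  let ?\<Theta> = "single_arm_instance N c"
  let ?v = "\<lambda>i::nat. if i = 1 then c else 0"
  note inst = single_arm_instance_in[OF N c]
  have one: "AE \<omega> in bandit_process N Q ?\<Theta>. reward i (Suc n) \<omega> = ?v i" if i: "i \<in> {1..N}" for i n
  proof -
    \<comment> \<open>Within the unit interval the complement of the atom is a null set of the arm's
      law.\<close>
    have A: "{0..1} - {?v i} \<in> sets unit_borel"
      by (auto simp: sets_restrict_space_iff)
    have "emeasure (?\<Theta> i) ({0..1} - {?v i}) = 0"
      using i A by (simp add: single_arm_instance_def)
    from AE_bandit_rewards[OF mp inst i A this, of n] AE_space
    show ?thesis
    proof eventually_elim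
      case (elim \<omega>)
      then show ?case
        using reward_in_unit[of \<omega> N i "Suc n"] i by (auto simp: space_bandit_process[OF mp inst])
    qed
  qed
  \<comment> \<open>Countably many rounds and finitely many arms leave a single exceptional null
    set.\<close>
  have "AE \<omega> in bandit_process N Q ?\<Theta>. \<forall>n. \<forall>i\<in>{1..N}. reward i (Suc n) \<omega> = ?v i"
    unfolding AE_all_countable by (intro allI AE_finite_allI one) auto
  then show ?thesis
  proof eventually_elim
    case (elim \<omega>)
    then show ?case
      by (metis Suc_le_D One_nat_def)
  qed
qed

text \<open>The extra 1 in the denominator scales the payoff of arm 1 by a factor in [0,1), also
  when it has not been pulled yet. Its mean therefore never exceeds \<open>c\<close>.\<close>

lemma emp_mean_single_arm:
  assumes "\<forall>t\<ge>1. \<forall>i\<in>{1..N}. reward i t \<omega> = (if i = 1 then c else 0)" "i \<in> {1..N}"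
  shows "emp_mean i t \<omega> = (if i = 1 then real (pulls 1 t \<omega>) / (real (pulls 1 t \<omega>) + 1) * c else 0)"
proof -
  have "(\<Sum>l | l \<in> {1..<t} \<and> action l \<omega> = i. reward i l \<omega>)
      = (\<Sum>l | l \<in> {1..<t} \<and> action l \<omega> = i. if i = 1 then c else 0)"
    using assms by (intro sum.cong) auto
  then show ?thesis
    unfolding emp_mean_def by (auto simp: pulls_card)
qed

text \<open>Swapping the sums turns the pull budget in \<open>exploratory\<close> into a sum of
  indicators over rounds, whose expectation is a sum of probabilities.\<close>

lemma sum_pulls_others:
  assumes "\<And>l. action l \<omega> \<in> {1..N}"
  shows "(\<Sum>i\<in>{1<..N}. pulls i t \<omega>) = (\<Sum>l\<in>{1..<t}. if action l \<omega> \<noteq> 1 then 1 else 0)"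
proof -
  have "(\<Sum>i\<in>{1<..N}. if action l \<omega> = i then 1 else 0) = (if action l \<omega> \<noteq> 1 then 1 else (0::nat))" for l
    using assms[of l] by (cases "action l \<omega> = 1") (auto simp: sum.delta)
  then show ?thesis
    unfolding pulls_def by (subst sum.swap) simp
qed

section \<open>Lower bound on the regret\<close>

lemma measurable_bandit_process_action:
  assumes mp: "markov_policy N Q" and inst: "\<Theta> \<in> bandit_instances N"
  shows "action t \<in> bandit_process N Q \<Theta> \<rightarrow>\<^sub>M count_space {1..N}"
  unfolding action_def
  by (rule measurable_compose[OF measurable_bandit_process_component[OF mp inst]])
     (simp add: round_space_def)

lemma measurable_bandit_process_obtained_reward:
  assumes mp: "markov_policy N Q" and inst: "\<Theta> \<in> bandit_instances N"
  shows "(\<lambda>\<omega>. reward (action t \<omega>) t \<omega>) \<in> borel_measurable (bandit_process N Q \<Theta>)"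
proof (rule measurable_compose_countable'[OF _ measurable_bandit_process_action[OF mp inst]])
  fix i assume "i \<in> {1..N}"
  then have "(\<lambda>p. snd p i) \<in> round_space N \<rightarrow>\<^sub>M unit_borel"
    unfolding round_space_def by (auto intro!: measurable_compose[OF measurable_snd])
  from measurable_compose[OF measurable_bandit_process_component[OF mp inst] this]
  show "reward i t \<in> borel_measurable (bandit_process N Q \<Theta>)"
    unfolding reward_def by (simp add: measurable_restrict_space2_iff)
qed simp

lemma sets_action_neq:
  assumes mp: "markov_policy N Q" and inst: "\<Theta> \<in> bandit_instances N"
  shows "{\<omega> \<in> space (bandit_process N Q \<Theta>). action t \<omega> \<noteq> i} \<in> sets (bandit_process N Q \<Theta>)"
proof -
  let ?M = "bandit_process N Q \<Theta>"
  from measurable_sets[OF measurable_bandit_process_action[OF mp inst], of "{1..N} - {i}" t]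
  have "action t -` ({1..N} - {i}) \<inter> space ?M \<in> sets ?M" by simp
  also have "action t -` ({1..N} - {i}) \<inter> space ?M = {\<omega> \<in> space ?M. action t \<omega> \<noteq> i}"
    using action_in_arms by (fastforce simp: space_bandit_process[OF mp inst])
  finally show ?thesis .
qed

text \<open>Almost surely a round pays the optimal mean \<open>c\<close>, or loses all of it when
  another arm is pulled. The regret is thus \<open>c\<close> times the expected number of rounds
  away from arm 1.\<close>

lemma regret_single_arm:
  assumes mp: "markov_policy N Q" and N: "N > 0" and c: "0 < c" "c \<le> 1"
  defines "M \<equiv> bandit_process N Q (single_arm_instance N c)"
  shows "regret N Q (single_arm_instance N c) T
       = c * (\<Sum>t\<in>{1..T}. measure M {\<omega> \<in> space M. action t \<omega> \<noteq> 1})"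
proof -
  note inst = single_arm_instance_in[OF N c]
  interpret prob_space M
    unfolding M_def by (rule prob_space_bandit_process[OF mp inst])
  have ev: "{\<omega> \<in> space M. action t \<omega> \<noteq> 1} \<in> events" for t
    unfolding M_def by (rule sets_action_neq[OF mp inst])
  let ?X = "\<lambda>t. indicator {\<omega> \<in> space M. action t \<omega> \<noteq> 1} :: _ \<Rightarrow> real"
  let ?R = "\<lambda>\<omega>. \<Sum>t\<in>{1..T}. c - c * ?X t \<omega>"
  have int: "integrable M (?X t)" for t
    using ev by (simp add: emeasure_eq_measure)
  have meas: "(\<lambda>\<omega>. \<Sum>t\<in>{1..T}. reward (action t \<omega>) t \<omega>) \<in> borel_measurable M"
    unfolding M_def by (intro borel_measurable_sum measurable_bandit_process_obtained_reward mp inst)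
  have AE: "AE \<omega> in M. (\<Sum>t\<in>{1..T}. reward (action t \<omega>) t \<omega>) = ?R \<omega>"
    using AE_single_arm_rewards[OF mp N c] AE_space unfolding M_def[symmetric]
  proof eventually_elim
    case (elim \<omega>)
    then have "action t \<omega> \<in> {1..N}" for t
      using action_in_arms by (auto simp: M_def space_bandit_process[OF mp inst])
    with elim show ?case
      by (intro sum.cong refl) (auto simp: indicator_def)
  qed
  have "(\<integral>\<omega>. (\<Sum>t\<in>{1..T}. reward (action t \<omega>) t \<omega>) \<partial>M) = (\<integral>\<omega>. ?R \<omega> \<partial>M)"
    using int by (intro integral_cong_AE meas AE) auto
  also have "\<dots> = (\<Sum>t\<in>{1..T}. c - c * prob {\<omega> \<in> space M. action t \<omega> \<noteq> 1})"
    using int ev by (simp add: prob_space Collect_conj_eq Int_absorb1)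
  finally show ?thesis
    unfolding regret_def M_def[symmetric] using N c
    by (simp add: opt_mean_single_arm sum_subtractf sum_distrib_left)
qed

text \<open>Replaces the threshold condition on the count of other pulls by a bound affine in that
  count. Below \<open>b\<close> it is weaker than the exploration bound \<open>\<epsilon>\<close>,
  and from \<open>b\<close> on it is at most 0. Being affine, it passes to expectations without any
  concentration estimate.\<close>

lemma policy_leaves_arm_1:
  assumes mp: "markov_policy N Q" and N: "N > 0" and c: "0 < c" "c \<le> 1"
    and \<epsilon>: "0 < \<epsilon>" and b: "0 < b"
    and explore: "\<forall>u\<in>{0..1}. u \<le> c \<longrightarrow> (\<forall>\<kappa> \<in> {1..N} \<rightarrow>\<^sub>E UNIV. real (\<Sum>i\<in>{1<..N}. \<kappa> i) < b \<longrightarrow>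
              1 - Q (\<kappa>, \<lambda>i\<in>{1..N}. if i = 1 then u else 0) 1 \<ge> \<epsilon>)"
    and rewards: "\<forall>t\<ge>1. \<forall>i\<in>{1..N}. reward i t \<omega> = (if i = 1 then c else 0)"
    and arms: "\<And>l. action l \<omega> \<in> {1..N}"
    and state: "bandit_state N t \<omega> \<in> space (state_space N)"
  shows "\<epsilon> - \<epsilon> / b * (\<Sum>l\<in>{1..<t}. if action l \<omega> \<noteq> 1 then 1 else 0)
       \<le> (\<Sum>i\<in>{1<..N}. Q (bandit_state N t \<omega>) i)"
proof -
  define k where "k = real (pulls 1 t \<omega>)"
  define u where "u = k / (k + 1) * c"
  define \<kappa> where "\<kappa> = (\<lambda>i\<in>{1..N}. pulls i t \<omega>)"
  define K where "K = (\<Sum>l\<in>{1..<t}. if action l \<omega> \<noteq> 1 then 1 else (0::real))"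
  have "k \<ge> 0" by (simp add: k_def)
  then have "u \<le> 1 * c" "0 \<le> u"
    unfolding u_def using c by (intro mult_right_mono mult_nonneg_nonneg; simp)+
  then have u: "u \<in> {0..1}" "u \<le> c" using c by auto
  \<comment> \<open>The state has exactly the shape quantified over in \<open>exploratory\<close>:
    one free mean and zeros elsewhere.\<close>
  have s: "bandit_state N t \<omega> = (\<kappa>, \<lambda>i\<in>{1..N}. if i = 1 then u else 0)"
    unfolding bandit_state_def \<kappa>_def u_def k_def
    by (auto intro!: restrict_ext simp: emp_mean_single_arm[OF rewards])
  have "(\<Sum>i\<in>{1<..N}. \<kappa> i) = (\<Sum>i\<in>{1<..N}. pulls i t \<omega>)"
    by (intro sum.cong) (auto simp: \<kappa>_def)
  then have K: "real (\<Sum>i\<in>{1<..N}. \<kappa> i) = K"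
    unfolding K_def by (simp only: sum_pulls_others[OF arms] of_nat_sum if_distrib of_nat_1 of_nat_0)
  have "{1..N} - {1} = {1<..N}" using N by auto
  then have q: "(\<Sum>i\<in>{1<..N}. Q (bandit_state N t \<omega>) i) = 1 - Q (bandit_state N t \<omega>) 1"
    using sum_policy[OF mp state, of "{1}"] N by simp
  show ?thesis
  proof (cases "K < b")
    case True
    then have "\<epsilon> \<le> 1 - Q (bandit_state N t \<omega>) 1"
      using explore u K by (auto simp: s \<kappa>_def)
    moreover have "0 \<le> \<epsilon> / b * K"
      using \<epsilon> b by (intro mult_nonneg_nonneg) (auto simp: K_def intro!: sum_nonneg)
    ultimately show ?thesis
      unfolding q K_def[symmetric] by linarith
  next
    case False
    \<comment> \<open>Once the budget is spent the claimed lower bound is nonpositive, so any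
      probability satisfies it.\<close>
    then have "\<epsilon> \<le> \<epsilon> / b * K"
      using \<epsilon> b by (simp add: field_simps)
    moreover have "Q (bandit_state N t \<omega>) 1 \<le> 1"
      using policy_le_1[OF mp state, of 1] N by simp
    ultimately show ?thesis
      unfolding q K_def[symmetric] by linarith
  qed
qed

text \<open>The expected count \<open>S\<close> of rounds away from arm 1 bounds itself: if
  \<open>S\<close> were small, the budget would mostly remain unspent and every round would leave
  arm 1 with probability close to \<open>\<epsilon>\<close>.\<close>

lemma sum_prob_leave_arm_1:
  assumes mp: "markov_policy N Q" and N: "N > 0" and c: "0 < c" "c \<le> 1"
    and \<epsilon>: "0 < \<epsilon>" and \<delta>: "0 < \<delta>" and T: "0 < T"
    and explore: "\<forall>u\<in>{0..1}. u \<le> c \<longrightarrow> (\<forall>\<kappa> \<in> {1..N} \<rightarrow>\<^sub>E UNIV. real (\<Sum>i\<in>{1<..N}. \<kappa> i) < \<delta> * real T \<longrightarrow>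
              1 - Q (\<kappa>, \<lambda>i\<in>{1..N}. if i = 1 then u else 0) 1 \<ge> \<epsilon>)"
  defines "M \<equiv> bandit_process N Q (single_arm_instance N c)"
  shows "\<epsilon> * \<delta> / (\<epsilon> + \<delta>) * real T \<le> (\<Sum>t\<in>{1..T}. measure M {\<omega> \<in> space M. action t \<omega> \<noteq> 1})"
proof -
  note inst = single_arm_instance_in[OF N c]
  interpret prob_space M
    unfolding M_def by (rule prob_space_bandit_process[OF mp inst])
  have ev: "{\<omega> \<in> space M. action t \<omega> \<noteq> 1} \<in> events" for t
    unfolding M_def by (rule sets_action_neq[OF mp inst])
  let ?X = "\<lambda>t. indicator {\<omega> \<in> space M. action t \<omega> \<noteq> 1} :: _ \<Rightarrow> real"
  define m where "m t = prob {\<omega> \<in> space M. action t \<omega> \<noteq> 1}" for t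
  define S where "S = (\<Sum>t\<in>{1..T}. m t)"
  have int: "integrable M (?X t)" for t
    using ev by (simp add: emeasure_eq_measure)
  have arms: "action l \<omega> \<in> {1..N}" if "\<omega> \<in> space M" for l \<omega>
    using action_in_arms that by (auto simp: M_def space_bandit_process[OF mp inst])
  have step: "\<epsilon> - \<epsilon> / (\<delta> * T) * S \<le> m t" if t: "t \<in> {1..T}" for t
  proof -
    obtain n where n: "t = Suc n" using t by (cases t) auto
    let ?q = "\<lambda>\<omega>. \<Sum>i\<in>{1<..N}. Q (bandit_state N t \<omega>) i"
    have st: "bandit_state N t \<in> M \<rightarrow>\<^sub>M state_space N"
      unfolding M_def n by (rule measurable_bandit_process_state[OF mp inst])
    have q01: "0 \<le> ?q \<omega>" "?q \<omega> \<le> 1" if "\<omega> \<in> space M" for \<omega>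
    proof -
      note s = measurable_space[OF st that]
      have "0 \<le> (\<Sum>i\<in>{1..N} - {1<..N}. Q (bandit_state N t \<omega>) i)"
        using mp s by (intro sum_nonneg) (auto simp: markov_policy_def)
      moreover have "{1<..N} \<subseteq> {1..N}" by auto
      ultimately show "?q \<omega> \<le> 1"
        using sum_policy[OF mp s, of "{1<..N}"] by linarith
      show "0 \<le> ?q \<omega>"
        using mp s by (intro sum_nonneg) (auto simp: markov_policy_def)
    qed
    have qm: "?q \<in> borel_measurable M"
      using mp by (intro borel_measurable_sum measurable_compose[OF st]) (auto simp: markov_policy_def)
    have qint: "integrable M ?q"
      by (intro integrable_const_bound[of _ 1] AE_I2 qm) (use q01 in auto)
    \<comment> \<open>Enlarging the pulls before round \<open>t\<close> to the total
      \<open>S\<close> makes the bound the same in every round, so no recursion in \<open>t\<close>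
      has to be solved.\<close>
    have "\<epsilon> - \<epsilon> / (\<delta> * T) * S \<le> \<epsilon> - \<epsilon> / (\<delta> * T) * (\<Sum>l\<in>{1..<t}. m l)"
      unfolding S_def using \<epsilon> \<delta> t
      by (intro diff_left_mono mult_left_mono sum_mono2) (auto simp: m_def)
    also have "\<dots> = (\<integral>\<omega>. \<epsilon> - \<epsilon> / (\<delta> * T) * (\<Sum>l\<in>{1..<t}. ?X l \<omega>) \<partial>M)"
      using int ev by (simp add: prob_space m_def Collect_conj_eq Int_absorb1)
    also have "\<dots> \<le> (\<integral>\<omega>. ?q \<omega> \<partial>M)"
    proof (intro integral_mono_AE qint)
      show "integrable M (\<lambda>\<omega>. \<epsilon> - \<epsilon> / (\<delta> * T) * (\<Sum>l\<in>{1..<t}. ?X l \<omega>))"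
        using int by auto
      show "AE \<omega> in M. \<epsilon> - \<epsilon> / (\<delta> * T) * (\<Sum>l\<in>{1..<t}. ?X l \<omega>) \<le> ?q \<omega>"
        using AE_single_arm_rewards[OF mp N c] AE_space unfolding M_def[symmetric]
      proof eventually_elim
        case (elim \<omega>)
        have "(\<Sum>l\<in>{1..<t}. ?X l \<omega>) = (\<Sum>l\<in>{1..<t}. if action l \<omega> \<noteq> 1 then 1 else 0)"
          using elim by (intro sum.cong) (auto simp: indicator_def)
        then show ?case
          using policy_leaves_arm_1[OF mp N c \<epsilon> _ explore elim(1) arms[OF elim(2)]
              measurable_space[OF st elim(2)]] \<delta> T by simp
      qed
    qed
    also have "\<dots> = prob {\<omega> \<in> space M. action t \<omega> \<in> {1<..N}}"
      unfolding M_def n by (rule prob_action_in[OF mp inst, symmetric]) auto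
    also have "{\<omega> \<in> space M. action t \<omega> \<in> {1<..N}} = {\<omega> \<in> space M. action t \<omega> \<noteq> 1}"
    proof (intro Collect_cong conj_cong refl)
      fix \<omega> assume "\<omega> \<in> space M"
      then show "action t \<omega> \<in> {1<..N} \<longleftrightarrow> action t \<omega> \<noteq> 1"
        using arms[of \<omega> t] by auto
    qed
    finally show ?thesis by (simp add: m_def)
  qed
  \<comment> \<open>Summing over the rounds gives one linear inequality,
    \<open>\<epsilon> * T - \<epsilon> / \<delta> * S \<le> S\<close>, from which \<open>S\<close>
    is isolated below.\<close>
  have "(\<Sum>t\<in>{1..T}. \<epsilon> - \<epsilon> / (\<delta> * T) * S) \<le> S"
    by (subst (2) S_def, rule sum_mono) (rule step)
  moreover have "(\<Sum>t\<in>{1..T}. \<epsilon> - \<epsilon> / (\<delta> * T) * S) = \<epsilon> * T - \<epsilon> / \<delta> * S"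
    using T \<delta> by (simp add: field_simps)
  ultimately have "\<epsilon> * T - \<epsilon> / \<delta> * S \<le> S"
    by simp
  then have "\<epsilon> * \<delta> / (\<epsilon> + \<delta>) * T \<le> S"
    using \<epsilon> \<delta> by (simp add: field_simps)
  then show ?thesis
    by (simp add: S_def m_def)
qed

text \<open>Trades the liminf for an eventual inequality with an explicit constant. One direction
  unpacks the hypothesis on \<open>\<Delta>\<close>, the other yields the final rate.\<close>

lemma asymp_lower_iff:
  assumes "\<forall>\<^sub>F T in sequentially. 0 < g T"
  shows "asymp_lower f g \<longleftrightarrow> (\<exists>d>0. \<forall>\<^sub>F T in sequentially. d * g T \<le> f T)"
proof
  assume "asymp_lower f g"
  \<comment> \<open>The liminf may be infinite, so a real strictly between 0 and it is
    taken.\<close>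
  then obtain d where d: "0 < ereal d" "ereal d < liminf (\<lambda>T. ereal (f T / g T))"
    unfolding asymp_lower_def by (meson ereal_dense2)
  from less_LiminfD[OF d(2)] assms have "\<forall>\<^sub>F T in sequentially. d * g T \<le> f T"
    by eventually_elim (simp add: field_simps)
  with d show "\<exists>d>0. \<forall>\<^sub>F T in sequentially. d * g T \<le> f T" by auto
next
  assume "\<exists>d>0. \<forall>\<^sub>F T in sequentially. d * g T \<le> f T"
  then obtain d where d: "d > 0" "\<forall>\<^sub>F T in sequentially. d * g T \<le> f T" by auto
  from d(2) assms have "\<forall>\<^sub>F T in sequentially. ereal d \<le> ereal (f T / g T)"
    by eventually_elim (simp add: field_simps)
  then have "ereal d \<le> liminf (\<lambda>T. ereal (f T / g T))"
    by (rule Liminf_bounded)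
  with d(1) show "asymp_lower f g"
    unfolding asymp_lower_def by (metis ereal_less(2) order_less_le_trans)
qed

theorem theorem5:
  fixes \<alpha> :: real and N :: nat and Q :: "state \<Rightarrow> nat \<Rightarrow> real"
  assumes "0 < \<alpha>" and "\<alpha> < 1 / 2"
    and "N > 1"
    and "markov_policy N Q"
    and "anonymous N Q"
    and "exploratory \<alpha> N Q"
  shows "asymp_lower (worst_case_regret N Q) (\<lambda>T. real T powr (1 - \<alpha>))"
proof -
  have pos: "\<forall>\<^sub>F T in sequentially. 0 < real T powr a" for a
    using eventually_gt_at_top[of 0] by eventually_elim simp
  obtain \<epsilon> \<delta> \<Delta> where \<epsilon>: "\<epsilon> > 0" and \<delta>: "0 < \<delta>"
    and \<Delta>: "asymp_lower \<Delta> (\<lambda>T. real T powr (- \<alpha>))"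
    and explore: "\<forall>\<^sub>F T in sequentially. \<forall>u\<in>{0..1}. u \<le> \<Delta> T \<longrightarrow>
           (\<forall>\<kappa> \<in> {1..N} \<rightarrow>\<^sub>E UNIV. real (\<Sum>i\<in>{1<..N}. \<kappa> i) < \<delta> * real T \<longrightarrow>
              1 - Q (\<kappa>, \<lambda>i\<in>{1..N}. if i = 1 then u else 0) 1 \<ge> \<epsilon>)"
    using assms(6) unfolding exploratory_def by auto
  obtain d where d: "d > 0" "\<forall>\<^sub>F T in sequentially. d * real T powr (- \<alpha>) \<le> \<Delta> T"
    using \<Delta> unfolding asymp_lower_iff[OF pos] by auto
  \<comment> \<open>The cap at 1 keeps the payoff \<open>c\<close> below inside the reward range
    [0,1].\<close>
  define d' where "d' = min d 1"
  define e where "e = \<epsilon> * \<delta> / (\<epsilon> + \<delta>)"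
  have "\<forall>\<^sub>F T in sequentially. d' * e * real T powr (1 - \<alpha>) \<le> worst_case_regret N Q T"
    using d(2) explore eventually_gt_at_top[of 0]
  proof eventually_elim
    case (elim T)
    \<comment> \<open>The instance varies with \<open>T\<close>, as it may, since
      \<open>worst_case_regret\<close> takes a separate supremum for each horizon. This payoff has
      the order of the exploration threshold and stays below \<open>\<Delta> T\<close>.\<close>
    define c where "c = d' * real T powr (- \<alpha>)"
    have "real T powr (- \<alpha>) \<le> 1"
      using powr_mono[of "- \<alpha>" 0 "real T"] elim(3) assms(1) by simp
    then have "d' * real T powr (- \<alpha>) \<le> 1 * 1"
      using d(1) by (intro mult_mono) (auto simp: d'_def)
    then have c: "0 < c" "c \<le> 1"
      using elim(3) d(1) by (auto simp: c_def d'_def)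
    have "c \<le> d * real T powr (- \<alpha>)"
      unfolding c_def d'_def by (intro mult_right_mono) auto
    then have "c \<le> \<Delta> T" using elim(1) by simp
    then have ex: "\<forall>u\<in>{0..1}. u \<le> c \<longrightarrow>
           (\<forall>\<kappa> \<in> {1..N} \<rightarrow>\<^sub>E UNIV. real (\<Sum>i\<in>{1<..N}. \<kappa> i) < \<delta> * real T \<longrightarrow>
              1 - Q (\<kappa>, \<lambda>i\<in>{1..N}. if i = 1 then u else 0) 1 \<ge> \<epsilon>)"
      using elim(2) by (meson order_trans)
    have N: "N > 0" using assms(3) by simp
    \<comment> \<open>The rate is a linear number of lost rounds times a loss of order
      \<open>real T powr (- \<alpha>)\<close> in each.\<close>
    have "real T powr (1 - \<alpha>) = real T * real T powr (- \<alpha>)"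
      using elim(3) by (simp add: powr_diff powr_minus_divide)
    then have "d' * e * real T powr (1 - \<alpha>) = c * (e * real T)"
      by (simp add: c_def)
    also have "\<dots> \<le> regret N Q (single_arm_instance N c) T"
      unfolding regret_single_arm[OF assms(4) N c] e_def
      using c sum_prob_leave_arm_1[OF assms(4) N c \<epsilon> \<delta> elim(3) ex] by (intro mult_left_mono) auto
    also have "\<dots> \<le> worst_case_regret N Q T"
      by (rule regret_le_worst_case[OF assms(4) single_arm_instance_in[OF N c] N])
    finally show ?case .
  qed
  moreover have "d' * e > 0"
    using d(1) \<epsilon> \<delta> by (simp add: d'_def e_def)
  ultimately show ?thesis
    unfolding asymp_lower_iff[OF pos] by blast
qed

end
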